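(* Let $N \ge 1$ be an integer, let $0 < p \le 1$, and let $\Theta^T, \Theta \in [0, \pi/2]$ be the angles determined by $\sin^2(\Theta^T) = p$ and $\sin^2(\Theta) = \frac{1}{N}$ (the superscript in $\Theta^T$ is only a label, not an exponent). Then every quantum query algorithm that solves the unordered search problem of size $N$ with success probability at least $p$ uses a number $T$ of oracle queries satisfying $$T \;\geq\; \frac{\Theta^T - \Theta}{2\,\Theta}.$$
   Context: Unordered search problem: the input is a bitstring $x \in \{0,1\}^N$, accessible only through an oracle, promised to have a unique index $1 \le i \le N$ with $x_i = 1$. The task is to output this index with probability at least $p$. The $N$ possible inputs are identified with $y \in \{1,\ldots,N\}$, where input $y$ denotes the bitstring $x$ with $x_y = 1$ and $x_i = 0$ for $i \ne y$. Oracle: the state space is a finite-dimensional complex Hilbert space with orthonormal basis $|i; w\rangle$, where $i \in \{0,1,\ldots,N\}$ is the query register and $w$ ranges over an arbitrary finite set of workspace basis labels. For a bitstring $x$, the oracle is the unitary $\mathsf{O}_x |i; w\rangle = (-1)^{x_i} |i; w\rangle$ if $1 \le i \le N$, and $\mathsf{O}_x |0; w\rangle = |0; w\rangle$. Write $\mathsf{O}_y$ for the oracle of input $y \in \{1,\ldots,N\}$. Quantum query algorithm with $T$ queries: it is given by unitary operators $\mathsf{U}_0, \mathsf{U}_1, \ldots, \mathsf{U}_T$ on the state space (independent of the input), a fixed unit start vector $|0\rangle$ (independent of the input), and a final von Neumann measurement given by mutually orthogonal projectors $\{\mathsf{\Pi}_y\}_{y \in \{1,\ldots,N\}}$ summing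 to the identity. On input $x$ the final state is $|\Psi_x^T\rangle = \mathsf{U}_T \mathsf{O}_x \mathsf{U}_{T-1} \cdots \mathsf{U}_1 \mathsf{O}_x \mathsf{U}_0 |0\rangle$, and the algorithm outputs $y$ with probability $\| \mathsf{\Pi}_y |\Psi_x^T\rangle \|^2$. The algorithm solves the unordered search problem with success probability at least $p$ if $\| \mathsf{\Pi}_y |\Psi_y^T\rangle \|^2 \ge p$ for every $y \in \{1,\ldots,N\}$. *)

theory Defs
  imports "HOL-Analysis.Analysis"
begin

text \<open>
  The indices \<open>1, \<dots>, N\<close> are the elements of a finite type \<open>'n\<close> with \<open>CARD('n) = N\<close>, and
  the workspace labels are the elements of a finite type \<open>'w\<close>.  The query register
  \<open>{0, 1, \<dots>, N}\<close> is \<open>'n option\<close>: \<open>None\<close> is the label \<open>0\<close> and \<open>Some i\<close> is the label \<open>i\<close>.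
  The basis vector \<open>|i; w\<rangle>\<close> is the standard basis vector of index \<open>(i, w)\<close>; the library's
  \<open>norm\<close> on \<open>complex ^ 's\<close> is the Hilbert space norm.
\<close>

type_synonym ('n, 'w) state = "complex ^ ('n option \<times> 'w)"
type_synonym ('n, 'w) operator = "complex ^ ('n option \<times> 'w) ^ ('n option \<times> 'w)"

definition conj_transpose :: "complex ^ 's ^ 's \<Rightarrow> complex ^ 's ^ 's" where
  "conj_transpose A = (\<chi> i j. cnj (A $ j $ i))"

definition unitary_matrix :: "complex ^ 's ^ 's \<Rightarrow> bool" where
  "unitary_matrix U \<longleftrightarrow>
     conj_transpose U ** U = mat 1 \<and> U ** conj_transpose U = mat 1"

definition orthogonal_projector :: "complex ^ 's ^ 's \<Rightarrow> bool" where
  "orthogonal_projector P \<longleftrightarrow> P ** P = P \<and> conj_transpose P = P"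

definition von_neumann_measurement :: "('n::finite \<Rightarrow> complex ^ 's ^ 's) \<Rightarrow> bool" where
  "von_neumann_measurement P \<longleftrightarrow>
     (\<forall>y. orthogonal_projector (P y)) \<and>
     (\<forall>y z. y \<noteq> z \<longrightarrow> P y ** P z = 0) \<and>
     (\<Sum>y\<in>UNIV. P y) = mat 1"

definition query_phase :: "('n \<Rightarrow> bool) \<Rightarrow> 'n option \<Rightarrow> complex" where
  "query_phase x q = (case q of None \<Rightarrow> 1 | Some i \<Rightarrow> (-1) ^ of_bool (x i))"

definition query_gate :: "('n::finite \<Rightarrow> bool) \<Rightarrow> ('n, 'w::finite) operator" where
  "query_gate x = (\<chi> a b. if a = b then query_phase x (fst a) else 0)"

definition search_input :: "'n \<Rightarrow> 'n \<Rightarrow> bool" where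
  "search_input y = (\<lambda>i. i = y)"

text \<open>
  A \<open>T\<close>-query algorithm is a triple \<open>U\<close>, \<open>\<psi>\<close>, \<open>P\<close>; only the entries \<open>U 0, \<dots>, U T\<close> of the
  sequence \<open>U\<close> are used.
\<close>

definition query_algorithm ::
  "nat \<Rightarrow> (nat \<Rightarrow> ('n::finite, 'w::finite) operator) \<Rightarrow> ('n, 'w) state
     \<Rightarrow> ('n \<Rightarrow> ('n, 'w) operator) \<Rightarrow> bool" where
  "query_algorithm T U \<psi> P \<longleftrightarrow>
     (\<forall>t\<le>T. unitary_matrix (U t)) \<and> norm \<psi> = 1 \<and> von_neumann_measurement P"

primrec final_state ::
  "(nat \<Rightarrow> ('n::finite, 'w::finite) operator) \<Rightarrow> ('n, 'w) state \<Rightarrow> ('n \<Rightarrow> bool)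
     \<Rightarrow> nat \<Rightarrow> ('n, 'w) state" where
  "final_state U \<psi> x 0 = U 0 *v \<psi>"
| "final_state U \<psi> x (Suc t) = U (Suc t) *v (query_gate x *v final_state U \<psi> x t)"

definition output_prob ::
  "nat \<Rightarrow> (nat \<Rightarrow> ('n::finite, 'w::finite) operator) \<Rightarrow> ('n, 'w) state
     \<Rightarrow> ('n \<Rightarrow> ('n, 'w) operator) \<Rightarrow> ('n \<Rightarrow> bool) \<Rightarrow> 'n \<Rightarrow> real" where
  "output_prob T U \<psi> P x y = (norm (P y *v final_state U \<psi> x T))\<^sup>2"

definition solves_search ::
  "nat \<Rightarrow> (nat \<Rightarrow> ('n::finite, 'w::finite) operator) \<Rightarrow> ('n, 'w) state
     \<Rightarrow> ('n \<Rightarrow> ('n, 'w) operator) \<Rightarrow> real \<Rightarrow> bool" where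
  "solves_search T U \<psi> P p \<longleftrightarrow> (\<forall>y. output_prob T U \<psi> P (search_input y) y \<ge> p)"

end

theory Submission
  imports Defs
begin

text \<open>
  Let \<open>\<Phi>\<close> be the run of the algorithm on the all-zero input. If \<open>q\<close> is the weight of the
  current state \<open>\<Phi>\<close> on the query \<open>y\<close>, then one query on input \<open>y\<close> rotates \<open>\<Phi>\<close> by the angle
  \<open>2 arcsin (sqrt q)\<close>, so the final angle between the runs on \<open>y\<close> and on zero is at most the sum
  of these angles over all queries. On the other hand, this final angle is at least
  \<open>\<Theta>\<^sub>T - arcsin \<parallel>P\<^sub>y \<Phi>\<parallel>\<close>. In each of the \<open>T\<close> queries, and in the final measurement, the
  weights over all \<open>y\<close> sum to at most 1, so the associated angles \<open>arcsin (sqrt q)\<close> have average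
  at most \<open>\<Theta>\<close>. Averaging over \<open>y\<close> gives \<open>\<Theta>\<^sub>T \<le> \<Theta> + 2 T \<Theta>\<close>.
\<close>

section \<open>Angles whose squared sines sum to at most one\<close>

text \<open>The second derivative is 2 cos (2x), which is nonnegative up to pi/4 and negative just
  beyond it.\<close>

lemma convex_on_sin_squared: "convex_on {0..pi/4} (\<lambda>x::real. (sin x)\<^sup>2)"
proof (rule f''_ge0_imp_convex[where f' = "\<lambda>x. 2 * sin x * cos x" and f'' = "\<lambda>x. 2 * ((cos x)\<^sup>2 - (sin x)\<^sup>2)"])
  show "convex {0..pi/4}" by simp
  show "((\<lambda>x. (sin x)\<^sup>2) has_real_derivative 2 * sin x * cos x) (at x)" for x
    by (auto intro!: derivative_eq_intros)
  show "((\<lambda>x. 2 * sin x * cos x) has_real_derivative 2 * ((cos x)\<^sup>2 - (sin x)\<^sup>2)) (at x)" for x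
    by (auto intro!: derivative_eq_intros simp: power2_eq_square algebra_simps)
  show "0 \<le> 2 * ((cos x)\<^sup>2 - (sin x)\<^sup>2)" if "x \<in> {0..pi/4}" for x
    unfolding cos_double[symmetric] using that cos_ge_zero[of "2 * x"] by simp
qed

text \<open>Jensen's inequality with equal weights bounds the squared sine of the mean angle by 1/N,
  and sine is increasing on [0, pi/2].\<close>

lemma sum_angles_le_quarter:
  fixes th :: "'n::finite \<Rightarrow> real"
  assumes range: "\<And>y. th y \<in> {0..pi/4}" and sq: "(\<Sum>y\<in>UNIV. (sin (th y))\<^sup>2) \<le> 1"
    and \<Theta>: "\<Theta> \<in> {0..pi/2}" "(sin \<Theta>)\<^sup>2 = 1 / real CARD('n)"
  shows "(\<Sum>y\<in>UNIV. th y) \<le> real CARD('n) * \<Theta>"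
proof -
  let ?N = "real CARD('n)"
  define m where "m = (\<Sum>y\<in>UNIV. (1 / ?N) *\<^sub>R th y)"
  have N: "?N > 0" by simp
  have m_eq: "m = (\<Sum>y\<in>UNIV. th y) / ?N"
    unfolding m_def by (simp add: sum_divide_distrib)
  have m0: "0 \<le> m"
    unfolding m_eq using range by (intro divide_nonneg_pos sum_nonneg) auto
  have "(\<Sum>y\<in>UNIV. th y) \<le> ?N * (pi/4)"
    using sum_bounded_above[of UNIV th "pi/4"] range by auto
  then have m1: "m \<le> pi/4"
    unfolding m_eq using N by (simp add: field_simps)
  have "(sin m)\<^sup>2 \<le> (\<Sum>y\<in>UNIV. (1 / ?N) * (sin (th y))\<^sup>2)"
    unfolding m_def
    by (rule convex_on_sum[OF _ _ convex_on_sin_squared]) (use range in auto)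
  also have "\<dots> = (\<Sum>y\<in>UNIV. (sin (th y))\<^sup>2) / ?N"
    by (simp add: sum_divide_distrib)
  also have "\<dots> \<le> (sin \<Theta>)\<^sup>2"
    using sq N unfolding \<Theta> by (simp add: divide_right_mono)
  finally have "sin m \<le> sin \<Theta>"
    by (rule power2_le_imp_le) (use \<Theta> in \<open>auto intro: sin_ge_zero\<close>)
  then have "m \<le> \<Theta>"
    using m0 m1 \<Theta> pi_gt_zero by (subst (asm) sin_mono_le_eq) auto
  then show ?thesis
    unfolding m_eq using N by (simp add: field_simps)
qed

text \<open>The right side is 1 - cos (a + b) cos (a - b) and the left side is 1 - cos (a + b).
  Since only cos (a + b) has to be nonnegative, one of the two angles may exceed pi/4.\<close>

lemma sin_squared_add_ge:
  fixes a b :: real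
  assumes "0 \<le> a" "0 \<le> b" "a + b \<le> pi/2"
  shows "2 * (sin ((a + b) / 2))\<^sup>2 \<le> (sin a)\<^sup>2 + (sin b)\<^sup>2"
proof -
  have "(sin x)\<^sup>2 = (1 - cos (2 * x)) / 2" for x :: real
    by (simp add: cos_double_sin)
  moreover have "cos (2 * a) + cos (2 * b) = 2 * (cos (a + b) * cos (a - b))"
    by (simp add: cos_times_cos)
  moreover have "cos (a + b) * cos (a - b) \<le> cos (a + b)"
    using assms cos_ge_zero[of "a + b"] mult_left_mono[of "cos (a - b)" 1 "cos (a + b)"] by simp
  ultimately show ?thesis by (simp add: add_divide_distrib diff_divide_distrib)
qed

text \<open>The squares give sin b \<le> cos a = sin (pi/2 - a), and sine is increasing on
  [0, pi/2].\<close>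

lemma add_le_pi_half:
  fixes a b :: real
  assumes "a \<in> {0..pi/2}" "b \<in> {0..pi/2}" "(sin a)\<^sup>2 + (sin b)\<^sup>2 \<le> 1"
  shows "a + b \<le> pi/2"
proof -
  have "(sin b)\<^sup>2 \<le> (sin (pi/2 - a))\<^sup>2"
    using assms(3) by (simp add: sin_squared_eq sin_diff)
  then have "sin b \<le> sin (pi/2 - a)"
    by (rule power2_le_imp_le) (use assms in \<open>auto intro: sin_ge_zero\<close>)
  then show ?thesis
    using assms by (subst (asm) sin_mono_le_eq) auto
qed

text \<open>
  \<open>sin\<^sup>2\<close> is convex only on \<open>[0, \<pi>/4]\<close>. At most one angle exceeds \<open>\<pi>/4\<close>; replacing it and one
  further angle by their mean keeps the sum of the angles, does not increase the sum of the
  squared sines, and brings all angles into the convex range.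
\<close>
lemma sum_angles_le:
  fixes th :: "'n::finite \<Rightarrow> real"
  assumes range: "\<And>y. th y \<in> {0..pi/2}" and sq: "(\<Sum>y\<in>UNIV. (sin (th y))\<^sup>2) \<le> 1"
    and \<Theta>: "\<Theta> \<in> {0..pi/2}" "(sin \<Theta>)\<^sup>2 = 1 / real CARD('n)"
  shows "(\<Sum>y\<in>UNIV. th y) \<le> real CARD('n) * \<Theta>"
proof (cases "\<exists>a b. a \<noteq> b \<and> th a > pi/4")
  case True
  then obtain a b where ab: "a \<noteq> b" "th a > pi/4" by blast
  have split: "(\<Sum>y\<in>UNIV. f y) = f a + f b + (\<Sum>y\<in>-{a,b}. f y)" for f :: "'n \<Rightarrow> real"
    using sum.subset_diff[of "{a,b}" UNIV f] ab by (simp add: Compl_eq_Diff_UNIV)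
  \<comment> \<open>As \<open>th a\<close> exceeds pi/4, this also keeps every other angle below
    pi/4.\<close>
  have pair: "th a + th y \<le> pi/2" if "y \<noteq> a" for y
  proof (rule add_le_pi_half[OF range range])
    have "(sin (th a))\<^sup>2 + (sin (th y))\<^sup>2 = (\<Sum>z\<in>{a,y}. (sin (th z))\<^sup>2)"
      using that by simp
    also have "\<dots> \<le> (\<Sum>y\<in>UNIV. (sin (th y))\<^sup>2)"
      by (rule sum_mono2) auto
    finally show "(sin (th a))\<^sup>2 + (sin (th y))\<^sup>2 \<le> 1" using sq by linarith
  qed
  define m where "m = (th a + th b) / 2"
  define th' where "th' = th(a := m, b := m)"
  have rest: "(\<Sum>y\<in>-{a,b}. f (th' y)) = (\<Sum>y\<in>-{a,b}. f (th y))" for f :: "real \<Rightarrow> real"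
    by (rule sum.cong) (auto simp: th'_def)
  have th'_ab: "th' a = m" "th' b = m" by (auto simp: th'_def)
  have "(\<Sum>y\<in>UNIV. th' y) \<le> real CARD('n) * \<Theta>"
  proof (rule sum_angles_le_quarter[OF _ _ \<Theta>])
    fix y
    show "th' y \<in> {0..pi/4}"
      using pair[of y] pair[of b] range[of a] range[of y] range[of b] ab
      by (auto simp: th'_def m_def)
  next
    have "2 * (sin m)\<^sup>2 \<le> (sin (th a))\<^sup>2 + (sin (th b))\<^sup>2"
      unfolding m_def using range[of a] range[of b] pair[of b] ab
      by (intro sin_squared_add_ge) auto
    then show "(\<Sum>y\<in>UNIV. (sin (th' y))\<^sup>2) \<le> 1"
      using sq split[of "\<lambda>y. (sin (th y))\<^sup>2"] split[of "\<lambda>y. (sin (th' y))\<^sup>2"]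
        rest[of "\<lambda>x. (sin x)\<^sup>2"] by (simp add: th'_ab)
  qed
  moreover have "(\<Sum>y\<in>UNIV. th' y) = (\<Sum>y\<in>UNIV. th y)"
    using split[of th] split[of th'] rest[of "\<lambda>x. x"] by (simp add: th'_ab m_def)
  ultimately show ?thesis by simp
next
  case False
  show ?thesis
  proof (cases "\<exists>a. th a > pi/4")
    case True
    then obtain a where a: "th a > pi/4" by blast
    \<comment> \<open>Without a second index to average with, N = 1; then \<Theta> = pi/2 and the
      range of the angle suffices.\<close>
    have "y = a" for y
      using False a by metis
    then have univ: "(UNIV :: 'n set) = {a}" by auto
    have sum: "(\<Sum>y\<in>UNIV. th y) = th a" and card: "CARD('n) = 1"
      unfolding univ by simp_all
    have "sin \<Theta> = 1"
      using \<Theta> card sin_ge_zero[of \<Theta>] by (auto simp: power2_eq_1_iff)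
    then have "\<Theta> = pi/2"
      using \<Theta> arcsin_sin[of \<Theta>] by simp
    then show ?thesis using sum card range[of a] by simp
  next
    case False
    then show ?thesis
      using range by (intro sum_angles_le_quarter[OF _ sq \<Theta>]) (auto simp: not_less)
  qed
qed

lemma sum_arcsin_le:
  fixes s :: "'n::finite \<Rightarrow> real"
  assumes "\<And>y. 0 \<le> s y" "(\<Sum>y\<in>UNIV. (s y)\<^sup>2) \<le> 1"
    and \<Theta>: "\<Theta> \<in> {0..pi/2}" "(sin \<Theta>)\<^sup>2 = 1 / real CARD('n)"
  shows "(\<Sum>y\<in>UNIV. arcsin (s y)) \<le> real CARD('n) * \<Theta>"
proof (rule sum_angles_le[OF _ _ \<Theta>])
  have "(s y)\<^sup>2 \<le> 1" for y
    using member_le_sum[of y UNIV "\<lambda>y. (s y)\<^sup>2"] assms(2) by simp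
  then have s1: "s y \<le> 1" for y
    by (simp add: power2_le_imp_le)
  show "arcsin (s y) \<in> {0..pi/2}" for y
    using s1[of y] assms(1)[of y] arcsin_ubound[of "s y"] arcsin_le_arcsin[of 0 "s y"] by simp
  have "sin (arcsin (s y)) = s y" for y
    using s1[of y] assms(1)[of y] by simp
  then show "(\<Sum>y\<in>UNIV. (sin (arcsin (s y)))\<^sup>2) \<le> 1"
    using assms(2) by simp
qed

section \<open>Angles between unit vectors\<close>

lemma inner_unit_bounds:
  fixes u v :: "'a::real_inner"
  assumes "norm u = 1" "norm v = 1"
  shows "-1 \<le> u \<bullet> v" "u \<bullet> v \<le> 1"
  using Cauchy_Schwarz_ineq2[of u v] assms by auto

text \<open>Triangle inequality on the unit sphere: removing the components along \<open>v\<close>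
  leaves vectors of lengths sin A and sin B, so Cauchy-Schwarz yields cos (A + B) \<le>
  \<open>u \<bullet> w\<close>.\<close>

lemma arccos_inner_triangle:
  fixes u v w :: "'a::real_inner"
  assumes u: "norm u = 1" and v: "norm v = 1" and w: "norm w = 1"
  shows "arccos (u \<bullet> w) \<le> arccos (u \<bullet> v) + arccos (v \<bullet> w)"
proof -
  define A B where "A = arccos (u \<bullet> v)" and "B = arccos (v \<bullet> w)"
  note bounds = inner_unit_bounds[OF u v] inner_unit_bounds[OF v w] inner_unit_bounds[OF u w]
  have cA: "cos A = u \<bullet> v" and cB: "cos B = v \<bullet> w"
    using bounds by (simp_all add: A_def B_def)
  have rA: "0 \<le> A" "A \<le> pi" and rB: "0 \<le> B" "B \<le> pi"
    using bounds by (simp_all add: A_def B_def arccos_lbound arccos_ubound)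
  show ?thesis
  proof (cases "A + B \<le> pi")
    case False
    then show ?thesis
      using arccos_ubound[of "u \<bullet> w"] bounds by (simp add: A_def B_def)
  next
    case True
    define u' w' where "u' = u - (u \<bullet> v) *\<^sub>R v" and "w' = w - (v \<bullet> w) *\<^sub>R v"
    have unit: "u \<bullet> u = 1" "v \<bullet> v = 1" "w \<bullet> w = 1"
      using u v w by (simp_all add: norm_eq_1)
    have "(norm u')\<^sup>2 = (sin A)\<^sup>2"
      unfolding u'_def power2_norm_eq_inner sin_squared_eq cA
      by (simp add: inner_diff inner_commute unit power2_eq_square)
    then have nu: "norm u' = sin A"
      using rA by (simp add: sin_ge_zero)
    have "(norm w')\<^sup>2 = (sin B)\<^sup>2"
      unfolding w'_def power2_norm_eq_inner sin_squared_eq cB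
      by (simp add: inner_diff inner_commute unit power2_eq_square)
    then have nw: "norm w' = sin B"
      using rB by (simp add: sin_ge_zero)
    have "u \<bullet> w = (u \<bullet> v) * (v \<bullet> w) + u' \<bullet> w'"
      unfolding u'_def w'_def by (simp add: inner_diff inner_commute unit algebra_simps)
    moreover have "\<bar>u' \<bullet> w'\<bar> \<le> sin A * sin B"
      using Cauchy_Schwarz_ineq2[of u' w'] by (simp add: nu nw)
    ultimately have "cos (A + B) \<le> u \<bullet> w"
      by (simp add: cos_add cA cB)
    then have "arccos (u \<bullet> w) \<le> arccos (cos (A + B))"
      using bounds by (intro arccos_le_arccos) auto
    also have "\<dots> = A + B"
      using True rA rB by (intro arccos_cos) auto
    finally show ?thesis by (simp add: A_def B_def)
  qed
qed

section \<open>Unitaries, projectors and the query gate\<close>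

lemma inner_complex_conv: "(a::complex) \<bullet> b = Re (cnj a * b)"
  by (simp add: inner_complex_def)

text \<open>The library inner product on complex vectors is the real part of the Hermitian one, so
  the conjugate transpose is still the adjoint.\<close>

lemma inner_conj_transpose:
  fixes A :: "complex ^ 's::finite ^ 's"
  shows "(A *v u) \<bullet> v = u \<bullet> (conj_transpose A *v v)"
proof -
  have "(A *v u) \<bullet> v = Re (\<Sum>i\<in>UNIV. \<Sum>j\<in>UNIV. cnj (A $ i $ j * u $ j) * v $ i)"
    by (simp add: inner_vec_def inner_complex_conv matrix_vector_mult_def sum_distrib_right)
  also have "\<dots> = Re (\<Sum>j\<in>UNIV. \<Sum>i\<in>UNIV. cnj (A $ i $ j * u $ j) * v $ i)"
    by (subst sum.swap) simp
  also have "\<dots> = u \<bullet> (conj_transpose A *v v)"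
    by (simp add: inner_vec_def inner_complex_conv matrix_vector_mult_def conj_transpose_def
        sum_distrib_left mult_ac)
  finally show ?thesis .
qed

lemma inner_unitary:
  fixes A :: "complex ^ 's::finite ^ 's"
  assumes "unitary_matrix A"
  shows "(A *v u) \<bullet> (A *v v) = u \<bullet> v"
  using assms by (simp add: inner_conj_transpose matrix_vector_mul_assoc unitary_matrix_def)

lemma norm_unitary:
  fixes A :: "complex ^ 's::finite ^ 's"
  assumes "unitary_matrix A"
  shows "norm (A *v u) = norm u"
  by (simp add: norm_eq_sqrt_inner inner_unitary[OF assms])

lemma inner_projector:
  fixes A :: "complex ^ 's::finite ^ 's"
  assumes "orthogonal_projector A"
  shows "(A *v u) \<bullet> (A *v v) = u \<bullet> (A *v v)"
  using assms by (simp add: inner_conj_transpose matrix_vector_mul_assoc orthogonal_projector_def)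

lemma norm_measurement_sum:
  fixes P :: "'n::finite \<Rightarrow> complex ^ 's::finite ^ 's"
  assumes "von_neumann_measurement P"
  shows "(\<Sum>y\<in>UNIV. (norm (P y *v u))\<^sup>2) = (norm u)\<^sup>2"
proof -
  have "(\<Sum>y\<in>UNIV. (norm (P y *v u))\<^sup>2) = u \<bullet> (\<Sum>y\<in>UNIV. P y *v u)"
    using assms
    by (simp add: von_neumann_measurement_def power2_norm_eq_inner inner_projector inner_sum_right)
  also have "(\<Sum>y\<in>UNIV. P y *v u) = (\<Sum>y\<in>UNIV. P y) *v u"
    by (simp add: vec_eq_iff matrix_vector_mult_def sum_distrib_right) (rule allI, rule sum.swap)
  finally show ?thesis
    using assms by (simp add: von_neumann_measurement_def power2_norm_eq_inner)
qed

text \<open>For a unit vector this arcsine is its angle to the kernel of \<open>A\<close>. Splitting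
  both vectors along range and kernel and applying Cauchy-Schwarz to each part bounds
  \<open>u \<bullet> v\<close> by cos (a - b).\<close>

lemma projector_angle:
  fixes A :: "complex ^ 's::finite ^ 's"
  assumes A: "orthogonal_projector A" and u: "norm u = 1" and v: "norm v = 1"
  shows "arcsin (norm (A *v u)) \<le> arcsin (norm (A *v v)) + arccos (u \<bullet> v)"
proof -
  have compl: "(x - A *v x) \<bullet> (y - A *v y) = x \<bullet> y - (A *v x) \<bullet> (A *v y)" for x y
    using inner_projector[OF A, of x y] inner_projector[OF A, of y x]
    by (simp add: inner_diff inner_commute)
  define a b where "a = arcsin (norm (A *v u))" and "b = arcsin (norm (A *v v))"
  have angle: "norm (A *v x) \<le> 1" "norm (x - A *v x) = cos (arcsin (norm (A *v x)))"
    "arcsin (norm (A *v x)) \<in> {0..pi/2}" if "norm x = 1" for x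
  proof -
    have eq: "(norm (x - A *v x))\<^sup>2 = 1 - (norm (A *v x))\<^sup>2"
      using compl[of x x] that by (simp add: power2_norm_eq_inner norm_eq_1)
    then have "(norm (A *v x))\<^sup>2 \<le> 1"
      using zero_le_power2[of "norm (x - A *v x)"] by linarith
    then show le: "norm (A *v x) \<le> 1"
      by (simp add: power2_le_imp_le)
    have ge: "-1 \<le> norm (A *v x)"
      using norm_ge_zero[of "A *v x"] by linarith
    show "norm (x - A *v x) = cos (arcsin (norm (A *v x)))"
      using eq le ge by (simp add: cos_arcsin real_sqrt_unique)
    show "arcsin (norm (A *v x)) \<in> {0..pi/2}"
      using le ge arcsin_ubound[OF ge le] arcsin_le_arcsin[of 0 "norm (A *v x)"] by simp
  qed
  have ge: "-1 \<le> norm (A *v x)" for x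
    using norm_ge_zero[of "A *v x"] by linarith
  have "u \<bullet> v = (A *v u) \<bullet> (A *v v) + (u - A *v u) \<bullet> (v - A *v v)"
    using compl[of u v] by simp
  also have "\<dots> \<le> sin a * sin b + cos a * cos b"
    using norm_cauchy_schwarz[of "A *v u" "A *v v"]
      norm_cauchy_schwarz[of "u - A *v u" "v - A *v v"] angle[OF u] angle[OF v] ge
    by (simp add: a_def b_def)
  \<comment> \<open>The absolute value places the difference in [0, pi], where arccos inverts
    cos.\<close>
  also have "\<dots> = cos (\<bar>a - b\<bar>)"
    by (simp add: cos_diff)
  finally have "arccos (cos \<bar>a - b\<bar>) \<le> arccos (u \<bullet> v)"
    using inner_unit_bounds[OF u v] by (intro arccos_le_arccos) auto
  moreover have "arccos (cos \<bar>a - b\<bar>) = \<bar>a - b\<bar>"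
    using angle(3)[OF u] angle(3)[OF v] by (intro arccos_cos) (auto simp: a_def b_def)
  ultimately show ?thesis by (simp add: a_def b_def)
qed

lemma query_gate_component:
  "(query_gate x *v v) $ a = query_phase x (fst a) * v $ a"
  by (simp add: query_gate_def matrix_vector_mult_def if_distrib[where f = "\<lambda>c. c * _"]
      sum.delta cong: if_cong)

lemma query_phase_cases: "query_phase x q = 1 \<or> query_phase x q = -1"
  by (cases q) (auto simp: query_phase_def)

lemma inner_query_gate: "(query_gate x *v u) \<bullet> (query_gate x *v v) = u \<bullet> v"
proof -
  have "(query_gate x *v u) $ a \<bullet> (query_gate x *v v) $ a = u $ a \<bullet> v $ a" for a
    using query_phase_cases[of x "fst a"] by (auto simp: query_gate_component)
  then show ?thesis by (simp add: inner_vec_def)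
qed

lemma norm_query_gate: "norm (query_gate x *v u) = norm u"
  by (simp add: norm_eq_sqrt_inner inner_query_gate)

lemma query_gate_zero: "query_gate (\<lambda>_. False) *v u = u"
  by (simp add: vec_eq_iff query_gate_component query_phase_def split: option.split)

text \<open>For a unit vector, this is the probability that measuring the query register gives
  \<open>Some y\<close>.\<close>

definition query_weight :: "('n::finite, 'w::finite) state \<Rightarrow> 'n \<Rightarrow> real" where
  "query_weight v y = (\<Sum>w\<in>UNIV. (cmod (v $ (Some y, w)))\<^sup>2)"

lemma query_weight_nonneg: "0 \<le> query_weight v y"
  by (simp add: query_weight_def sum_nonneg)

lemma norm_squared_query_weight:
  fixes v :: "('n::finite, 'w::finite) state"
  shows "(norm v)\<^sup>2 = (\<Sum>w\<in>UNIV. (cmod (v $ (None, w)))\<^sup>2) + (\<Sum>y\<in>UNIV. query_weight v y)"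
proof -
  have "(norm v)\<^sup>2 = (\<Sum>q\<in>UNIV. \<Sum>w\<in>UNIV. (cmod (v $ (q, w)))\<^sup>2)"
    by (simp add: norm_vec_def L2_set_def sum_nonneg UNIV_Times_UNIV[symmetric]
        sum.cartesian_product del: UNIV_Times_UNIV)
  then show ?thesis
    by (simp add: UNIV_option_conv sum.reindex query_weight_def)
qed

lemma sum_query_weight_le:
  fixes v :: "('n::finite, 'w::finite) state"
  assumes "norm v = 1"
  shows "(\<Sum>y\<in>UNIV. query_weight v y) \<le> 1"
  using norm_squared_query_weight[of v] assms
    sum_nonneg[of UNIV "\<lambda>w. (cmod (v $ (None, w)))\<^sup>2"] by simp

text \<open>The gate flips the sign of exactly the \<open>Some y\<close> components, and each flip
  costs twice the squared modulus.\<close>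

lemma inner_query_gate_search:
  fixes v :: "('n::finite, 'w::finite) state"
  shows "(query_gate (search_input y) *v v) \<bullet> v = (norm v)\<^sup>2 - 2 * query_weight v y"
proof -
  let ?f = "\<lambda>a. (query_gate (search_input y) *v v) $ a \<bullet> v $ a"
  have comp: "?f (q, w) = (cmod (v $ (q, w)))\<^sup>2 - (if q = Some y then 2 * (cmod (v $ (q, w)))\<^sup>2 else 0)"
    for q w
    by (cases q) (auto simp: query_gate_component query_phase_def search_input_def
        power2_norm_eq_inner)
  have "(query_gate (search_input y) *v v) \<bullet> v = (\<Sum>q\<in>UNIV. \<Sum>w\<in>UNIV. ?f (q, w))"
    by (simp add: inner_vec_def UNIV_Times_UNIV[symmetric]
        sum.cartesian_product del: UNIV_Times_UNIV)
  also have "\<dots> = (\<Sum>q\<in>UNIV. \<Sum>w\<in>UNIV. (cmod (v $ (q, w)))\<^sup>2)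
      - (\<Sum>q\<in>UNIV. if q = Some y then \<Sum>w\<in>UNIV. 2 * (cmod (v $ (q, w)))\<^sup>2 else 0)"
    unfolding comp sum_subtractf[symmetric] by (intro sum.cong refl) (auto simp: sum_subtractf)
  also have "(\<Sum>q\<in>UNIV. \<Sum>w\<in>UNIV. (cmod (v $ (q, w)))\<^sup>2) = (norm v)\<^sup>2"
    by (simp add: norm_vec_def L2_set_def sum_nonneg UNIV_Times_UNIV[symmetric]
        sum.cartesian_product del: UNIV_Times_UNIV)
  finally show ?thesis
    by (simp add: query_weight_def sum_distrib_left)
qed

text \<open>With s the square root of the weight, 1 - 2 s * s = cos (2 arcsin s), and the doubled
  angle lies in [0, pi].\<close>

lemma query_angle:
  fixes v :: "('n::finite, 'w::finite) state"
  assumes v: "norm v = 1"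
  shows "arccos ((query_gate (search_input y) *v v) \<bullet> v) = 2 * arcsin (sqrt (query_weight v y))"
proof -
  let ?s = "sqrt (query_weight v y)"
  have "query_weight v y \<le> 1"
    using member_le_sum[of y UNIV "query_weight v"] sum_query_weight_le[OF v]
    by (simp add: query_weight_nonneg)
  then have s: "0 \<le> ?s" "?s \<le> 1"
    by (simp_all add: query_weight_nonneg)
  have sin: "sin (arcsin ?s) = ?s"
    using s by (intro sin_arcsin) linarith+
  have "(query_gate (search_input y) *v v) \<bullet> v = cos (2 * arcsin ?s)"
    using v sin by (simp add: inner_query_gate_search cos_double_sin query_weight_nonneg)
  moreover have "0 \<le> arcsin ?s" "arcsin ?s \<le> pi/2"
    using s arcsin_ubound[of ?s] order_trans[OF _ s(1), of "-1"] by (simp_all add: arcsin_nonneg)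
  ultimately show ?thesis by (simp add: arccos_cos)
qed

section \<open>The lower bound\<close>

lemma norm_final_state:
  assumes "\<And>t. t \<le> T \<Longrightarrow> unitary_matrix (U t)" "norm \<psi> = 1" "t \<le> T"
  shows "norm (final_state U \<psi> x t) = 1"
  using assms(3) by (induction t) (simp_all add: assms norm_unitary norm_query_gate)

text \<open>Hybrid argument: query number s + 1 acts on the state with index s, so t queries
  contribute the terms with s < t. The weights come from the zero run, which is the same for all
  \<open>y\<close>; this allows summing over \<open>y\<close> later.\<close>

lemma final_state_angle:
  fixes U :: "nat \<Rightarrow> ('n::finite, 'w::finite) operator"
  assumes U: "\<And>t. t \<le> T \<Longrightarrow> unitary_matrix (U t)" and \<psi>: "norm \<psi> = 1" and "t \<le> T"
  defines "\<Phi> \<equiv> final_state U \<psi> (\<lambda>_. False)"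
  shows "arccos (final_state U \<psi> (search_input y) t \<bullet> \<Phi> t)
    \<le> (\<Sum>s<t. 2 * arcsin (sqrt (query_weight (\<Phi> s) y)))"
  using \<open>t \<le> T\<close>
proof (induction t)
  case 0
  then show ?case
    by (simp add: \<Phi>_def U \<psi> norm_unitary dot_square_norm)
next
  case (Suc t)
  let ?\<Psi> = "final_state U \<psi> (search_input y) t" and ?O = "query_gate (search_input y)"
  have norms: "norm ?\<Psi> = 1" "norm (\<Phi> t) = 1"
    using norm_final_state[OF U \<psi>] Suc.prems by (auto simp: \<Phi>_def)
  have "final_state U \<psi> (search_input y) (Suc t) \<bullet> \<Phi> (Suc t) = (?O *v ?\<Psi>) \<bullet> \<Phi> t"
    using U[OF Suc.prems] by (simp add: \<Phi>_def query_gate_zero inner_unitary)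
  \<comment> \<open>The intermediate vector applies the gate of input \<open>y\<close> to the zero
    run: the first angle is the old one, the second is the rotation by a single query.\<close>
  also have "arccos \<dots> \<le> arccos ((?O *v ?\<Psi>) \<bullet> (?O *v \<Phi> t)) + arccos ((?O *v \<Phi> t) \<bullet> \<Phi> t)"
    by (rule arccos_inner_triangle) (simp_all add: norm_query_gate norms)
  also have "\<dots> = arccos (?\<Psi> \<bullet> \<Phi> t) + 2 * arcsin (sqrt (query_weight (\<Phi> t) y))"
    by (simp add: inner_query_gate query_angle[OF norms(2)])
  finally show ?case
    using Suc by simp
qed

theorem theorem9:
  fixes N T :: nat
    and p \<Theta>\<^sub>T \<Theta> :: real
    and U :: "nat \<Rightarrow> ('n::finite, 'w::finite) operator"
    and \<psi> :: "('n, 'w) state"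
    and P :: "'n \<Rightarrow> ('n, 'w) operator"
  assumes "N \<ge> 1" and "CARD('n) = N"
    and "0 < p" and "p \<le> 1"
    and "\<Theta>\<^sub>T \<in> {0..pi/2}" and "(sin \<Theta>\<^sub>T)\<^sup>2 = p"
    and "\<Theta> \<in> {0..pi/2}" and "(sin \<Theta>)\<^sup>2 = 1 / real N"
    and "query_algorithm T U \<psi> P"
    and "solves_search T U \<psi> P p"
  shows "real T \<ge> (\<Theta>\<^sub>T - \<Theta>) / (2 * \<Theta>)"
proof -
  define \<Phi> where "\<Phi> = final_state U \<psi> (\<lambda>_. False)"
  define \<Psi> where "\<Psi> y = final_state U \<psi> (search_input y) T" for y
  have U: "\<And>t. t \<le> T \<Longrightarrow> unitary_matrix (U t)" and \<psi>: "norm \<psi> = 1"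
    and P: "von_neumann_measurement P"
    using assms(9) by (auto simp: query_algorithm_def)
  have proj: "orthogonal_projector (P y)" for y
    using P by (simp add: von_neumann_measurement_def)
  have \<Phi>: "norm (\<Phi> t) = 1" if "t \<le> T" for t
    using norm_final_state[OF U \<psi> that] by (simp add: \<Phi>_def)
  have \<Psi>: "norm (\<Psi> y) = 1" for y
    using norm_final_state[OF U \<psi>] by (simp add: \<Psi>_def)
  have \<Theta>: "\<Theta> \<in> {0..pi/2}" "(sin \<Theta>)\<^sup>2 = 1 / real CARD('n)"
    using assms(2,7,8) by auto
  have "\<Theta> \<noteq> 0"
    using assms(1,8) by auto
  then have \<Theta>_pos: "0 < \<Theta>"
    using \<Theta> by simp

  \<comment> \<open>Success on \<open>y\<close> makes the measured angle of \<open>\<Psi> y\<close>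
    at least \<open>\<Theta>\<^sub>T\<close>; passing to the zero run costs at most the accumulated
    query angles.\<close>
  have each: "\<Theta>\<^sub>T \<le> arcsin (norm (P y *v \<Phi> T))
      + (\<Sum>t<T. 2 * arcsin (sqrt (query_weight (\<Phi> t) y)))" for y
  proof -
    have "(sin \<Theta>\<^sub>T)\<^sup>2 \<le> (norm (P y *v \<Psi> y))\<^sup>2"
      using assms(6,10) by (simp add: solves_search_def output_prob_def \<Psi>_def)
    then have le: "sin \<Theta>\<^sub>T \<le> norm (P y *v \<Psi> y)"
      by (rule power2_le_imp_le) simp
    have "(norm (P y *v \<Psi> y))\<^sup>2 \<le> 1"
      using member_le_sum[of y UNIV "\<lambda>y'. (norm (P y' *v \<Psi> y))\<^sup>2"]
        norm_measurement_sum[OF P, of "\<Psi> y"] \<Psi> by simp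
    then have "norm (P y *v \<Psi> y) \<le> 1"
      by (simp add: power2_le_imp_le)
    then have "\<Theta>\<^sub>T \<le> arcsin (norm (P y *v \<Psi> y))"
      using arcsin_le_arcsin[OF _ le] assms(5) by (simp add: arcsin_sin)
    also have "\<dots> \<le> arcsin (norm (P y *v \<Phi> T)) + arccos (\<Psi> y \<bullet> \<Phi> T)"
      by (rule projector_angle[OF proj \<Psi>]) (simp add: \<Phi>)
    finally show ?thesis
      using final_state_angle[of T U \<psi> T y] U \<psi> by (simp add: \<Phi>_def \<Psi>_def)
  qed
  have query: "(\<Sum>y\<in>UNIV. arcsin (sqrt (query_weight (\<Phi> t) y))) \<le> real CARD('n) * \<Theta>"
    if "t < T" for t
    using that sum_query_weight_le[OF \<Phi>[of t]]
    by (intro sum_arcsin_le[OF _ _ \<Theta>]) (simp_all add: query_weight_nonneg)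
  have measure: "(\<Sum>y\<in>UNIV. arcsin (norm (P y *v \<Phi> T))) \<le> real CARD('n) * \<Theta>"
    by (rule sum_arcsin_le[OF _ _ \<Theta>]) (simp_all add: norm_measurement_sum[OF P] \<Phi>)

  have "real CARD('n) * \<Theta>\<^sub>T = (\<Sum>y\<in>(UNIV::'n set). \<Theta>\<^sub>T)" by simp
  also have "\<dots> \<le> (\<Sum>y\<in>UNIV. arcsin (norm (P y *v \<Phi> T))
      + (\<Sum>t<T. 2 * arcsin (sqrt (query_weight (\<Phi> t) y))))"
    by (intro sum_mono each)
  \<comment> \<open>Exchanging the sums puts all \<open>y\<close> together for a fixed query, where
    the weights total at most 1.\<close>
  also have "\<dots> = (\<Sum>y\<in>UNIV. arcsin (norm (P y *v \<Phi> T)))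
      + 2 * (\<Sum>t<T. \<Sum>y\<in>UNIV. arcsin (sqrt (query_weight (\<Phi> t) y)))"
    by (simp add: sum.distrib sum_distrib_left sum.swap[of _ "{..<T}" UNIV])
  also have "\<dots> \<le> real CARD('n) * \<Theta> + 2 * (\<Sum>t<T. real CARD('n) * \<Theta>)"
    using measure query by (intro add_mono mult_left_mono sum_mono) auto
  also have "\<dots> = real CARD('n) * (\<Theta> + 2 * real T * \<Theta>)"
    by (simp add: algebra_simps)
  finally have "\<Theta>\<^sub>T \<le> \<Theta> + 2 * real T * \<Theta>"
    by simp
  then show ?thesis
    using \<Theta>_pos by (simp add: divide_le_eq algebra_simps)
qed

end
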